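(* Over a field $K$ of characteristic $0$, the (Koszul) dual operad $\mathcal{A}s_3^{!}$ of the quadratic operad $\mathcal{A}s_3$ is the left-alternative operad with the additional identity $$(x,y,z)+(y,z,x)+(z,x,y)=0;$$ that is, $\mathcal{A}s_3^{!}$ is the operad governing algebras with one bilinear operation defined by the (linearized) left-alternative identity $(x,y,z)+(y,x,z)=0$ and the identity $(x,y,z)+(y,z,x)+(z,x,y)=0$, where $(x,y,z)=(xy)z-x(yz)$ is the associator.
   Context: A third-type associative algebra is an associative (not necessarily unital) $K$-algebra satisfying the identity $abc+bac-bca-cba=0$. $\mathcal{A}s_3$ denotes the variety of such algebras and the binary quadratic operad governing it. *)

theory Defs
  imports Complex_Main "HOL-Library.Poly_Mapping" "HOL-Combinatorics.Permutations"
begin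

section \<open>The free operad on one binary operation without symmetry\<close>

text \<open>
  Monomials of the free operad on the regular \<open>S\<^sub>2\<close>-module \<open>K[S\<^sub>2]\<close> are bracketings
  with labelled leaves; those of arity \<open>n\<close> carry each of the labels \<open>1, \<dots>, n\<close> exactly once.
  The label \<open>i\<close> stands for the \<open>i\<close>-th argument.
\<close>

datatype mon = Arg nat | Mul mon mon

primrec leaves :: "mon \<Rightarrow> nat list" where
  "leaves (Arg i) = [i]"
| "leaves (Mul s t) = leaves s @ leaves t"

primrec subst :: "(nat \<Rightarrow> mon) \<Rightarrow> mon \<Rightarrow> mon" where
  "subst h (Arg i) = h i"
| "subst h (Mul s t) = Mul (subst h s) (subst h t)"

definition monomials :: "nat \<Rightarrow> mon set" where
  "monomials n = {t. distinct (leaves t) \<and> set (leaves t) = {1..n}}"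

definition mon_act :: "mon \<Rightarrow> (nat \<Rightarrow> nat) \<Rightarrow> mon" where
  "mon_act t \<sigma> = subst (\<lambda>j. Arg (inv \<sigma> j)) t"

definition mon_comp :: "nat \<Rightarrow> mon \<Rightarrow> mon \<Rightarrow> mon" where
  "mon_comp i s t =
     subst (\<lambda>j. if j < i then Arg j
                else if j = i then subst (\<lambda>l. Arg (l + i - 1)) t
                else Arg (j + length (leaves t) - 1)) s"

definition scale :: "'k::field \<Rightarrow> (mon \<Rightarrow>\<^sub>0 'k) \<Rightarrow> (mon \<Rightarrow>\<^sub>0 'k)" where
  "scale c f = Poly_Mapping.map ((*) c) f"

lemma lookup_scale [simp]: "Poly_Mapping.lookup (scale c f) t = c * Poly_Mapping.lookup f t"
  by (simp add: scale_def Poly_Mapping.map.rep_eq when_def)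

lemma vector_space_scale: "vector_space (scale :: 'k::field \<Rightarrow> _)"
  by unfold_locales (auto intro!: poly_mapping_eqI simp: lookup_add algebra_simps)

definition Mag :: "nat \<Rightarrow> (mon \<Rightarrow>\<^sub>0 'k::field) set" where
  "Mag n = {f. Poly_Mapping.keys f \<subseteq> monomials n}"

text \<open>The right action of \<open>S\<^sub>n\<close>: \<open>(f \<sigma>)(x\<^sub>1, \<dots>, x\<^sub>n)\<close> has \<open>x\<^bsub>\<sigma>\<^sup>-\<^sup>1(i)\<^esub>\<close> in place of \<open>x\<^sub>i\<close>.\<close>

definition act :: "(mon \<Rightarrow>\<^sub>0 'k::field) \<Rightarrow> (nat \<Rightarrow> nat) \<Rightarrow> (mon \<Rightarrow>\<^sub>0 'k)" where
  "act f \<sigma> =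
     (\<Sum>t\<in>Poly_Mapping.keys f. Poly_Mapping.single (mon_act t \<sigma>) (Poly_Mapping.lookup f t))"

definition pcomp :: "nat \<Rightarrow> (mon \<Rightarrow>\<^sub>0 'k::field) \<Rightarrow> (mon \<Rightarrow>\<^sub>0 'k) \<Rightarrow> (mon \<Rightarrow>\<^sub>0 'k)" where
  "pcomp i f g =
     (\<Sum>s\<in>Poly_Mapping.keys f. \<Sum>t\<in>Poly_Mapping.keys g.
        Poly_Mapping.single (mon_comp i s t) (Poly_Mapping.lookup f s * Poly_Mapping.lookup g t))"

section \<open>Operads presented by generators and relations\<close>

definition operadic_ideal :: "(nat \<Rightarrow> (mon \<Rightarrow>\<^sub>0 'k::field) set) \<Rightarrow> bool" where
  "operadic_ideal I \<longleftrightarrow>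
     (\<forall>n. I n \<subseteq> Mag n \<and> module.subspace scale (I n)) \<and>
     (\<forall>n. \<forall>f\<in>I n. \<forall>\<sigma>. \<sigma> permutes {1..n} \<longrightarrow> act f \<sigma> \<in> I n) \<and>
     (\<forall>m n. \<forall>i\<in>{1..m}. \<forall>f\<in>I m. \<forall>g\<in>Mag n. pcomp i f g \<in> I (m + n - 1)) \<and>
     (\<forall>m n. \<forall>i\<in>{1..m}. \<forall>f\<in>Mag m. \<forall>g\<in>I n. pcomp i f g \<in> I (m + n - 1))"

definition generated_ideal :: "(mon \<Rightarrow>\<^sub>0 'k::field) set \<Rightarrow> nat \<Rightarrow> (mon \<Rightarrow>\<^sub>0 'k) set" where
  "generated_ideal R n = \<Inter>{I n | I. operadic_ideal I \<and> R \<subseteq> I 3}"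

record ('k, 'a) operad =
  component :: "nat \<Rightarrow> 'a set"
  op_add :: "nat \<Rightarrow> 'a \<Rightarrow> 'a \<Rightarrow> 'a"
  op_scale :: "nat \<Rightarrow> 'k \<Rightarrow> 'a \<Rightarrow> 'a"
  op_act :: "nat \<Rightarrow> 'a \<Rightarrow> (nat \<Rightarrow> nat) \<Rightarrow> 'a"
  op_unit :: 'a
  op_comp :: "nat \<Rightarrow> nat \<Rightarrow> nat \<Rightarrow> 'a \<Rightarrow> 'a \<Rightarrow> 'a"

definition coset ::
    "(nat \<Rightarrow> (mon \<Rightarrow>\<^sub>0 'k::field) set) \<Rightarrow> nat \<Rightarrow> (mon \<Rightarrow>\<^sub>0 'k) \<Rightarrow> (mon \<Rightarrow>\<^sub>0 'k) set" where
  "coset I n f = {g. g - f \<in> I n}"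

text \<open>
  The operations are computed on representatives; for an operadic ideal the unions below
  are unions of copies of a single coset.
  The arguments \<open>m i n\<close> of the partial composition belong to
  \<open>\<circ>\<^sub>i : P(m) \<otimes> P(n) \<rightarrow> P(m + n - 1)\<close>.
\<close>

definition quotient_operad ::
    "(nat \<Rightarrow> (mon \<Rightarrow>\<^sub>0 'k::field) set) \<Rightarrow> ('k, (mon \<Rightarrow>\<^sub>0 'k) set) operad" where
  "quotient_operad I =
     \<lparr> component = (\<lambda>n. coset I n ` Mag n),
       op_add = (\<lambda>n A B. \<Union>f\<in>A. \<Union>g\<in>B. coset I n (f + g)),
       op_scale = (\<lambda>n c A. \<Union>f\<in>A. coset I n (scale c f)),
       op_act = (\<lambda>n A \<sigma>. \<Union>f\<in>A. coset I n (act f \<sigma>)),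
       op_unit = coset I 1 (Poly_Mapping.single (Arg 1) 1),
       op_comp = (\<lambda>m i n A B. \<Union>f\<in>A. \<Union>g\<in>B. coset I (m + n - 1) (pcomp i f g)) \<rparr>"

text \<open>
  The binary quadratic operad governing the algebras with one bilinear operation that satisfy
  the multilinear identities \<open>r = 0\<close> of degree three, for \<open>r \<in> R\<close>.
\<close>

definition quadratic_operad ::
    "(mon \<Rightarrow>\<^sub>0 'k::field) set \<Rightarrow> ('k, (mon \<Rightarrow>\<^sub>0 'k) set) operad" where
  "quadratic_operad R = quotient_operad (generated_ideal R)"

section \<open>The Koszul dual operad\<close>

definition relation_module :: "(mon \<Rightarrow>\<^sub>0 'k::field) set \<Rightarrow> (mon \<Rightarrow>\<^sub>0 'k) set" where
  "relation_module R = module.span scale {act r \<sigma> | r \<sigma>. r \<in> R \<and> \<sigma> permutes {1..3}}"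

text \<open>
  The Koszul dual of the operad with generators \<open>E\<close> and relations \<open>R\<close> has generators
  \<open>E\<^sup>\<or> = E\<^sup>* \<otimes> sgn\<close> and relations the annihilator of \<open>R\<close> under the pairing of the arity three
  components of the free operads on \<open>E\<^sup>\<or>\<close> and \<open>E\<close>, in which \<open>\<alpha> \<circ>\<^sub>u \<beta>\<close> and \<open>\<mu> \<circ>\<^sub>v \<nu>\<close> pair to
  \<open>\<alpha>(\<mu>) \<beta>(\<nu>)\<close> if the shuffle types \<open>u, v\<close> agree and to \<open>0\<close> otherwise.
  Here \<open>E = K[S\<^sub>2]\<close> has basis \<open>\<mu>, \<mu>\<^sup>o\<^sup>p\<close>, and \<open>E\<^sup>\<or>\<close> is again regular, generated by \<open>\<mu>\<^sup>*\<close>, whose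
  opposite operation is \<open>-(\<mu>\<^sup>o\<^sup>p)\<^sup>*\<close>.  After the identification \<open>\<mu>\<^sup>* = \<mu>\<close> the pairing is diagonal
  on monomials: \<open>(x\<^sub>i x\<^sub>j) x\<^sub>k\<close> pairs with itself to the sign of \<open>1 2 3 \<mapsto> i j k\<close>, and
  \<open>x\<^sub>i (x\<^sub>j x\<^sub>k)\<close> pairs with itself to minus that sign.
\<close>

definition word_sign :: "nat list \<Rightarrow> int" where
  "word_sign w = sign (\<lambda>x. if x \<in> {1..length w} then w ! (x - 1) else x)"

fun mon_sign :: "mon \<Rightarrow> int" where
  "mon_sign (Mul (Mul (Arg i) (Arg j)) (Arg k)) = word_sign [i, j, k]"
| "mon_sign (Mul (Arg i) (Mul (Arg j) (Arg k))) = - word_sign [i, j, k]"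
| "mon_sign _ = 0"

definition pairing :: "(mon \<Rightarrow>\<^sub>0 'k::field) \<Rightarrow> (mon \<Rightarrow>\<^sub>0 'k) \<Rightarrow> 'k" where
  "pairing f g =
     (\<Sum>t\<in>monomials 3. of_int (mon_sign t) * Poly_Mapping.lookup f t * Poly_Mapping.lookup g t)"

definition orthogonal :: "(mon \<Rightarrow>\<^sub>0 'k::field) set \<Rightarrow> (mon \<Rightarrow>\<^sub>0 'k) set" where
  "orthogonal R = {f \<in> Mag 3. \<forall>g\<in>R. pairing f g = 0}"

definition koszul_dual ::
    "(mon \<Rightarrow>\<^sub>0 'k::field) set \<Rightarrow> ('k, (mon \<Rightarrow>\<^sub>0 'k) set) operad" where
  "koszul_dual R = quadratic_operad (orthogonal (relation_module R))"

section \<open>The identities\<close>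

definition left_word :: "nat \<Rightarrow> nat \<Rightarrow> nat \<Rightarrow> (mon \<Rightarrow>\<^sub>0 'k::field)" where
  "left_word x y z = Poly_Mapping.single (Mul (Mul (Arg x) (Arg y)) (Arg z)) 1"

definition right_word :: "nat \<Rightarrow> nat \<Rightarrow> nat \<Rightarrow> (mon \<Rightarrow>\<^sub>0 'k::field)" where
  "right_word x y z = Poly_Mapping.single (Mul (Arg x) (Mul (Arg y) (Arg z))) 1"

definition associator :: "nat \<Rightarrow> nat \<Rightarrow> nat \<Rightarrow> (mon \<Rightarrow>\<^sub>0 'k::field)" where
  "associator x y z = left_word x y z - right_word x y z"

text \<open>In the presence of associativity the choice of bracketing in \<open>abc\<close> is immaterial.\<close>

definition third_type_identity :: "nat \<Rightarrow> nat \<Rightarrow> nat \<Rightarrow> (mon \<Rightarrow>\<^sub>0 'k::field)" where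
  "third_type_identity a b c =
     left_word a b c + left_word b a c - left_word b c a - left_word c b a"

definition As3_relations :: "(mon \<Rightarrow>\<^sub>0 'k::field) set" where
  "As3_relations = {associator 1 2 3, third_type_identity 1 2 3}"

definition left_alternative_identity :: "nat \<Rightarrow> nat \<Rightarrow> nat \<Rightarrow> (mon \<Rightarrow>\<^sub>0 'k::field)" where
  "left_alternative_identity x y z = associator x y z + associator y x z"

definition cyclic_associator_identity :: "nat \<Rightarrow> nat \<Rightarrow> nat \<Rightarrow> (mon \<Rightarrow>\<^sub>0 'k::field)" where
  "cyclic_associator_identity x y z = associator x y z + associator y z x + associator z x y"

end

theory Submission
  imports Defs
begin

text \<open>
  Both sides are quotients of the same free operad, so it is enough that the two sets of
  relations generate the same operadic ideal.

  The pairing is diagonal on the twelve monomials of arity three.  Orthogonality to all permuted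
  associators therefore says that the coefficients of \<open>(x\<^sub>a x\<^sub>b) x\<^sub>c\<close> and \<open>x\<^sub>a (x\<^sub>b x\<^sub>c)\<close> are opposite:
  the annihilator consists of combinations \<open>\<Sum> c\<^bsub>abc\<^esub> (x\<^sub>a, x\<^sub>b, x\<^sub>c)\<close> of associators.
  Orthogonality to the third-type identity adds
  \<open>c\<^bsub>abc\<^esub> - c\<^bsub>bac\<^esub> - c\<^bsub>bca\<^esub> + c\<^bsub>cba\<^esub> = 0\<close>, the signs of the permutations being absorbed
  (\<open>in_orthogonal_As3_iff\<close>).  These equations say that the three differences
  \<open>c\<^sub>1\<^sub>2\<^sub>3 - c\<^sub>2\<^sub>1\<^sub>3\<close>, \<open>c\<^sub>2\<^sub>3\<^sub>1 - c\<^sub>3\<^sub>2\<^sub>1\<close> and \<open>c\<^sub>3\<^sub>1\<^sub>2 - c\<^sub>1\<^sub>3\<^sub>2\<close> have a common value \<open>d\<close>.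
  Subtracting \<open>d\<close> times the cyclic identity leaves coefficients that are symmetric in the first
  two letters, which is a combination of the three left-alternative identities
  (\<open>orthogonal_As3_decomposition\<close>).  Conversely both identities satisfy the equations.
\<close>

section \<open>Monomials of arity three\<close>

abbreviation left_mon :: "nat \<Rightarrow> nat \<Rightarrow> nat \<Rightarrow> mon" where
  "left_mon a b c \<equiv> Mul (Mul (Arg a) (Arg b)) (Arg c)"

abbreviation right_mon :: "nat \<Rightarrow> nat \<Rightarrow> nat \<Rightarrow> mon" where
  "right_mon a b c \<equiv> Mul (Arg a) (Mul (Arg b) (Arg c))"

definition arrangement :: "nat \<Rightarrow> nat \<Rightarrow> nat \<Rightarrow> bool" where
  "arrangement a b c \<longleftrightarrow> distinct [a, b, c] \<and> {a, b, c} = {1..3}"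

lemma arrangement_iff:
  "arrangement a b c \<longleftrightarrow>
     (a, b, c) \<in> {(1,2,3), (2,1,3), (2,3,1), (3,2,1), (3,1,2), (1,3,2)}"
proof
  assume "arrangement a b c"
  then have ne: "a \<noteq> b" "b \<noteq> c" "a \<noteq> c" and "a \<in> {1..3}" "b \<in> {1..3}" "c \<in> {1..3}"
    unfolding arrangement_def by auto
  then have "a = 1 \<or> a = 2 \<or> a = 3" "b = 1 \<or> b = 2 \<or> b = 3" "c = 1 \<or> c = 2 \<or> c = 3"
    by auto
  with ne show "(a, b, c) \<in> {(1,2,3), (2,1,3), (2,3,1), (3,2,1), (3,1,2), (1,3,2)}"
    by (elim disjE) simp_all
next
  have three: "{1..3} = {1, 2, 3::nat}" by auto
  assume "(a, b, c) \<in> {(1,2,3), (2,1,3), (2,3,1), (3,2,1), (3,1,2), (1,3,2)}"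
  then show "arrangement a b c"
    unfolding arrangement_def three by (auto simp del: One_nat_def)
qed

lemma arrangement_permutations:
  assumes "arrangement a b c"
  shows "arrangement b a c" "arrangement b c a" "arrangement c a b" "arrangement c b a"
  using assms by (simp_all add: arrangement_def insert_commute)

lemma leaves_nonempty: "leaves t \<noteq> []"
  by (induction t) auto

lemma leaves_eq_single_iff: "leaves t = [i] \<longleftrightarrow> t = Arg i"
  by (cases t) (auto simp: append_eq_Cons_conv leaves_nonempty)

lemma leaves_eq_pair_iff: "leaves t = [i, j] \<longleftrightarrow> t = Mul (Arg i) (Arg j)"
  by (cases t) (auto simp: append_eq_Cons_conv leaves_nonempty leaves_eq_single_iff)

lemma leaves_eq_triple_iff:
  "leaves t = [i, j, k] \<longleftrightarrow> t = left_mon i j k \<or> t = right_mon i j k"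
  by (cases t)
     (auto simp: append_eq_Cons_conv leaves_nonempty leaves_eq_single_iff leaves_eq_pair_iff)

lemma monomials_3_iff:
  "t \<in> monomials 3 \<longleftrightarrow>
     (\<exists>a b c. arrangement a b c \<and> (t = left_mon a b c \<or> t = right_mon a b c))"
proof
  assume t: "t \<in> monomials 3"
  then have "length (leaves t) = 3"
    using distinct_card[of "leaves t"] by (simp add: monomials_def)
  then obtain a b c where abc: "leaves t = [a, b, c]"
    by (auto simp: numeral_3_eq_3 length_Suc_conv)
  with t have "arrangement a b c" by (simp add: monomials_def arrangement_def)
  with abc show "\<exists>a b c. arrangement a b c \<and> (t = left_mon a b c \<or> t = right_mon a b c)"
    unfolding leaves_eq_triple_iff by blast
next
  assume "\<exists>a b c. arrangement a b c \<and> (t = left_mon a b c \<or> t = right_mon a b c)"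
  then show "t \<in> monomials 3"
    by (elim exE conjE disjE) (simp_all add: monomials_def arrangement_def)
qed

lemma finite_monomials_3: "finite (monomials 3)"
proof (rule finite_subset)
  let ?N = "{1..3::nat}"
  show "monomials 3 \<subseteq> (\<Union>a\<in>?N. \<Union>b\<in>?N. \<Union>c\<in>?N. {left_mon a b c, right_mon a b c})"
  proof
    fix t assume "t \<in> monomials 3"
    then obtain a b c where abc: "arrangement a b c" "t = left_mon a b c \<or> t = right_mon a b c"
      unfolding monomials_3_iff by blast
    then have "a \<in> ?N" "b \<in> ?N" "c \<in> ?N"
      unfolding arrangement_def by blast+
    with abc(2) show "t \<in> (\<Union>a\<in>?N. \<Union>b\<in>?N. \<Union>c\<in>?N. {left_mon a b c, right_mon a b c})"
      by blast
  qed
qed auto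

lemma word_sign_triple:
  "word_sign [a, b, c] = sign (id(1 := a, 2 := b, 3 := c))"
proof -
  have "(if x \<in> {1..length [a, b, c]} then [a, b, c] ! (x - 1) else x) =
      (id(1 := a, 2 := b, 3 := c)) x" for x
  proof (cases "x \<in> {1..length [a, b, c]}")
    case True
    then have "x = 1 \<or> x = 2 \<or> x = 3" by auto
    then show ?thesis by (elim disjE) simp_all
  qed auto
  then show ?thesis unfolding word_sign_def by presburger
qed

lemma word_sign_values:
  "word_sign [1, 2, 3] = 1" "word_sign [2, 1, 3] = -1" "word_sign [2, 3, 1] = 1"
  "word_sign [3, 2, 1] = -1" "word_sign [3, 1, 2] = 1" "word_sign [1, 3, 2] = -1"
proof -
  have eq: "id(1 := 1, 2 := 2, 3 := 3) = (id :: nat \<Rightarrow> nat)"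
    by (rule ext) simp
  show "word_sign [1, 2, 3] = 1"
    unfolding word_sign_triple eq by simp
  have eq: "id(1 := 2, 2 := 1, 3 := 3) = transpose 1 (2::nat)"
    by (rule ext) (simp add: transpose_def)
  show "word_sign [2, 1, 3] = -1"
    unfolding word_sign_triple eq by (simp add: sign_swap_id)
  have eq: "id(1 := 3, 2 := 2, 3 := 1) = transpose 1 (3::nat)"
    by (rule ext) (simp add: transpose_def)
  show "word_sign [3, 2, 1] = -1"
    unfolding word_sign_triple eq by (simp add: sign_swap_id)
  have eq: "id(1 := 1, 2 := 3, 3 := 2) = transpose 2 (3::nat)"
    by (rule ext) (simp add: transpose_def)
  show "word_sign [1, 3, 2] = -1"
    unfolding word_sign_triple eq by (simp add: sign_swap_id)
  have eq: "id(1 := 2, 2 := 3, 3 := 1) = transpose 1 (2::nat) \<circ> transpose 2 3"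
    by (rule ext) (simp add: transpose_def)
  show "word_sign [2, 3, 1] = 1"
    unfolding word_sign_triple eq by (simp add: sign_swap_id sign_compose permutation_swap_id)
  have eq: "id(1 := 3, 2 := 1, 3 := 2) = transpose 2 (3::nat) \<circ> transpose 1 2"
    by (rule ext) (simp add: transpose_def)
  show "word_sign [3, 1, 2] = 1"
    unfolding word_sign_triple eq by (simp add: sign_swap_id sign_compose permutation_swap_id)
qed

lemma word_sign_arrangement:
  assumes "arrangement a b c"
  shows "word_sign [a, b, c] \<noteq> 0"
    and "word_sign [b, a, c] = - word_sign [a, b, c]"
    and "word_sign [b, c, a] = word_sign [a, b, c]"
    and "word_sign [c, b, a] = - word_sign [a, b, c]"
proof -
  have "word_sign [a, b, c] \<noteq> 0 \<and> word_sign [b, a, c] = - word_sign [a, b, c] \<and>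
      word_sign [b, c, a] = word_sign [a, b, c] \<and> word_sign [c, b, a] = - word_sign [a, b, c]"
    using assms unfolding arrangement_iff insert_iff empty_iff prod.inject
    by (elim disjE FalseE conjE; simp only: word_sign_values) simp_all
  then show "word_sign [a, b, c] \<noteq> 0"
    and "word_sign [b, a, c] = - word_sign [a, b, c]"
    and "word_sign [b, c, a] = word_sign [a, b, c]"
    and "word_sign [c, b, a] = - word_sign [a, b, c]"
    by blast+
qed

section \<open>The action of the symmetric group\<close>

lemma act_eq_sum:
  assumes "finite A" "Poly_Mapping.keys f \<subseteq> A"
  shows "act f \<sigma> =
    (\<Sum>t\<in>A. Poly_Mapping.single (mon_act t \<sigma>) (Poly_Mapping.lookup f t))"
  unfolding act_def using assms
  by (intro sum.mono_neutral_left) (auto simp: in_keys_iff)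

lemma act_add: "act (f + g) \<sigma> = act f \<sigma> + act g \<sigma>"
proof -
  let ?A = "Poly_Mapping.keys f \<union> Poly_Mapping.keys g"
  have "act h \<sigma> = (\<Sum>t\<in>?A. Poly_Mapping.single (mon_act t \<sigma>) (Poly_Mapping.lookup h t))"
    if "h \<in> {f, g, f + g}" for h
    using that Poly_Mapping.keys_add[of f g] by (intro act_eq_sum) auto
  then show ?thesis by (simp add: lookup_add single_add sum.distrib)
qed

lemma act_diff: "act (f - g) \<sigma> = act f \<sigma> - act g \<sigma>"
  using act_add[of "f - g" g \<sigma>] by (simp add: algebra_simps)

lemma act_left_word: "act (left_word a b c) \<sigma> = left_word (inv \<sigma> a) (inv \<sigma> b) (inv \<sigma> c)"
  by (simp add: act_def left_word_def mon_act_def)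

lemma act_right_word: "act (right_word a b c) \<sigma> = right_word (inv \<sigma> a) (inv \<sigma> b) (inv \<sigma> c)"
  by (simp add: act_def right_word_def mon_act_def)

lemma act_associator: "act (associator a b c) \<sigma> = associator (inv \<sigma> a) (inv \<sigma> b) (inv \<sigma> c)"
  by (simp add: associator_def act_diff act_left_word act_right_word)

lemmas act_identities =
  act_associator act_add act_diff act_left_word third_type_identity_def
  left_alternative_identity_def

lemma arrangement_inv:
  assumes "\<sigma> permutes {1..3}"
  shows "arrangement (inv \<sigma> 1) (inv \<sigma> 2) (inv \<sigma> 3)"
proof -
  have p: "inv \<sigma> permutes {1..3}" using assms by (rule permutes_inv)
  have three: "{1..3} = {1, 2, 3::nat}" by auto
  have "inj (inv \<sigma>)" using p by (rule permutes_inj)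
  moreover have "inv \<sigma> ` {1..3} = {1..3}" using p by (rule permutes_image)
  ultimately show ?thesis
    unfolding arrangement_def three by (auto simp: inj_eq)
qed

lemma permutation_of_arrangement:
  assumes "arrangement a b c"
  obtains \<sigma> where "\<sigma> permutes {1..3}" "inv \<sigma> 1 = a" "inv \<sigma> 2 = b" "inv \<sigma> 3 = c"
proof -
  define \<tau> :: "nat \<Rightarrow> nat"
    where "\<tau> x = (if x = 1 then a else if x = 2 then b else if x = 3 then c else x)" for x
  have three: "{1..3} = {1, 2, 3::nat}" by auto
  have "\<tau> permutes {1..3}"
  proof (rule bij_imp_permutes)
    show "bij_betw \<tau> {1..3} {1..3}"
      using assms unfolding bij_betw_def inj_on_def arrangement_def three by (auto simp: \<tau>_def)
  qed (auto simp: \<tau>_def)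
  then have "inv \<tau> permutes {1..3}" "inv (inv \<tau>) = \<tau>"
    by (auto simp: permutes_inv permutes_inv_inv)
  then show thesis by (intro that[of "inv \<tau>"]) (auto simp: \<tau>_def)
qed

section \<open>The annihilator of the third-type relations\<close>

lemma pairing_add: "pairing f (g + h) = pairing f g + pairing f h"
  by (simp add: pairing_def lookup_add algebra_simps sum.distrib)

lemma pairing_diff: "pairing f (g - h) = pairing f g - pairing f h"
  using pairing_add[of f "g - h" h] by simp

lemma pairing_scale: "pairing f (scale c g) = c * pairing f g"
  by (simp add: pairing_def sum_distrib_left mult_ac)

lemma pairing_single:
  assumes "t \<in> monomials 3"
  shows "pairing f (Poly_Mapping.single t 1) = of_int (mon_sign t) * Poly_Mapping.lookup f t"
proof -
  have "pairing f (Poly_Mapping.single t 1) =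
      (\<Sum>s\<in>monomials 3.
        if s = t then of_int (mon_sign t) * Poly_Mapping.lookup f t else 0)"
    unfolding pairing_def by (intro sum.cong) (auto simp: lookup_single when_def)
  then show ?thesis using assms finite_monomials_3 by simp
qed

lemma pairing_left_word:
  assumes "arrangement a b c"
  shows "pairing f (left_word a b c) =
    of_int (word_sign [a, b, c]) * Poly_Mapping.lookup f (left_mon a b c)"
  using assms unfolding left_word_def by (subst pairing_single) (auto simp: monomials_3_iff)

lemma pairing_associator:
  assumes "arrangement a b c"
  shows "pairing f (associator a b c) = of_int (word_sign [a, b, c]) *
    (Poly_Mapping.lookup f (left_mon a b c) + Poly_Mapping.lookup f (right_mon a b c))"
proof -
  have "pairing f (right_word a b c) =
      - of_int (word_sign [a, b, c]) * Poly_Mapping.lookup f (right_mon a b c)"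
    using assms unfolding right_word_def by (subst pairing_single) (auto simp: monomials_3_iff)
  then show ?thesis
    by (simp add: associator_def pairing_diff pairing_left_word[OF assms] algebra_simps)
qed

lemma pairing_third_type_identity:
  assumes "arrangement a b c"
  shows "pairing f (third_type_identity a b c) = of_int (word_sign [a, b, c]) *
    (Poly_Mapping.lookup f (left_mon a b c) - Poly_Mapping.lookup f (left_mon b a c)
     - Poly_Mapping.lookup f (left_mon b c a) + Poly_Mapping.lookup f (left_mon c b a))"
proof -
  have "arrangement b a c" "arrangement b c a" "arrangement c b a"
    using arrangement_permutations[OF assms] by simp_all
  then show ?thesis
    using assms
    by (simp add: third_type_identity_def pairing_add pairing_diff pairing_left_word
        word_sign_arrangement[OF assms] algebra_simps)
qed

lemma in_orthogonal_relation_module_iff: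
  "f \<in> orthogonal (relation_module R) \<longleftrightarrow>
     f \<in> Mag 3 \<and> (\<forall>r\<in>R. \<forall>\<sigma>. \<sigma> permutes {1..3} \<longrightarrow> pairing f (act r \<sigma>) = 0)"
proof -
  interpret vector_space "scale :: 'a \<Rightarrow> _" by (rule vector_space_scale)
  let ?G = "{act r \<sigma> | r \<sigma>. r \<in> R \<and> \<sigma> permutes {1..3}}"
  have "subspace {g. pairing f g = 0}"
    by (rule subspaceI) (auto simp: pairing_add pairing_scale, simp add: pairing_def)
  then have "(\<forall>g\<in>span ?G. pairing f g = 0) \<longleftrightarrow> (\<forall>g\<in>?G. pairing f g = 0)"
    using span_minimal[of ?G "{g. pairing f g = 0}"] span_superset[of ?G] by blast
  then show ?thesis unfolding orthogonal_def relation_module_def by blast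
qed

text \<open>
  Every \<open>\<sigma>\<close> contributes one pair of equations, indexed by the arrangement \<open>\<sigma>\<^sup>-\<^sup>1(1), \<sigma>\<^sup>-\<^sup>1(2), \<sigma>\<^sup>-\<^sup>1(3)\<close>
  of the arguments in its word; the common factor \<open>\<plusminus>1\<close> of each equation is cancelled.
\<close>

lemma in_orthogonal_As3_iff:
  fixes f :: "mon \<Rightarrow>\<^sub>0 'k::field_char_0"
  shows "f \<in> orthogonal (relation_module As3_relations) \<longleftrightarrow>
     f \<in> Mag 3 \<and>
     (\<forall>a b c. arrangement a b c \<longrightarrow>
        Poly_Mapping.lookup f (right_mon a b c) = - Poly_Mapping.lookup f (left_mon a b c) \<and>
        Poly_Mapping.lookup f (left_mon a b c) - Poly_Mapping.lookup f (left_mon b a c)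
        - Poly_Mapping.lookup f (left_mon b c a) + Poly_Mapping.lookup f (left_mon c b a) = 0)"
    (is "_ \<longleftrightarrow> _ \<and> (\<forall>a b c. arrangement a b c \<longrightarrow> ?E a b c)")
proof -
  have E: "?E a b c \<longleftrightarrow>
      pairing f (associator a b c) = 0 \<and> pairing f (third_type_identity a b c) = 0"
    if "arrangement a b c" for a b c
  proof -
    have "x = - y \<longleftrightarrow> y + x = 0" for x y :: 'k
      by (metis add_eq_0_iff)
    then show ?thesis
      using word_sign_arrangement(1)[OF that]
      by (simp add: pairing_associator[OF that] pairing_third_type_identity[OF that])
  qed
  have "(\<forall>r\<in>As3_relations. pairing f (act r \<sigma>) = 0) \<longleftrightarrow>
      ?E (inv \<sigma> 1) (inv \<sigma> 2) (inv \<sigma> 3)" if "\<sigma> permutes {1..3}" for \<sigma>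
    unfolding E[OF arrangement_inv[OF that]]
    by (simp add: As3_relations_def act_identities)
  then have "(\<forall>r\<in>As3_relations. \<forall>\<sigma>. \<sigma> permutes {1..3} \<longrightarrow> pairing f (act r \<sigma>) = 0) \<longleftrightarrow>
      (\<forall>\<sigma>. \<sigma> permutes {1..3} \<longrightarrow> ?E (inv \<sigma> 1) (inv \<sigma> 2) (inv \<sigma> 3))"
    by blast
  also have "\<dots> \<longleftrightarrow> (\<forall>a b c. arrangement a b c \<longrightarrow> ?E a b c)"
  proof (intro iffI allI impI)
    fix a b c
    assume perms: "\<forall>\<sigma>. \<sigma> permutes {1..3} \<longrightarrow> ?E (inv \<sigma> 1) (inv \<sigma> 2) (inv \<sigma> 3)"
      and "arrangement a b c"
    obtain \<sigma> where "\<sigma> permutes {1..3}" "inv \<sigma> 1 = a" "inv \<sigma> 2 = b" "inv \<sigma> 3 = c"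
      using permutation_of_arrangement[OF \<open>arrangement a b c\<close>] .
    with perms show "?E a b c" by blast
  next
    fix \<sigma> :: "nat \<Rightarrow> nat"
    assume all: "\<forall>a b c. arrangement a b c \<longrightarrow> ?E a b c" and "\<sigma> permutes {1..3}"
    show "?E (inv \<sigma> 1) (inv \<sigma> 2) (inv \<sigma> 3)"
      by (rule all[rule_format, OF arrangement_inv[OF \<open>\<sigma> permutes {1..3}\<close>]])
  qed
  finally show ?thesis unfolding in_orthogonal_relation_module_iff by simp
qed

lemmas lookup_identities =
  left_alternative_identity_def cyclic_associator_identity_def associator_def
  left_word_def right_word_def lookup_add lookup_minus lookup_single when_def

lemma dual_identities_in_Mag:
  assumes "arrangement a b c"
  shows "left_alternative_identity a b c \<in> Mag 3" "cyclic_associator_identity a b c \<in> Mag 3"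
proof -
  have "arrangement b a c" "arrangement b c a" "arrangement c a b"
    using arrangement_permutations[OF assms] by simp_all
  then have "left_mon a b c \<in> monomials 3" "right_mon a b c \<in> monomials 3"
    "left_mon b a c \<in> monomials 3" "right_mon b a c \<in> monomials 3"
    "left_mon b c a \<in> monomials 3" "right_mon b c a \<in> monomials 3"
    "left_mon c a b \<in> monomials 3" "right_mon c a b \<in> monomials 3"
    using assms unfolding monomials_3_iff by blast+
  then show "left_alternative_identity a b c \<in> Mag 3" "cyclic_associator_identity a b c \<in> Mag 3"
    unfolding Mag_def by (auto simp: in_keys_iff lookup_identities split: if_splits)
qed

lemma dual_identities_orthogonal_As3:
  "left_alternative_identity 1 2 3
     \<in> orthogonal (relation_module (As3_relations :: (mon \<Rightarrow>\<^sub>0 'k::field_char_0) set))"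
  "cyclic_associator_identity 1 2 3
     \<in> orthogonal (relation_module (As3_relations :: (mon \<Rightarrow>\<^sub>0 'k::field_char_0) set))"
proof -
  have "arrangement 1 2 3" by (simp add: arrangement_iff)
  from dual_identities_in_Mag[OF this] show
    "left_alternative_identity 1 2 3
       \<in> orthogonal (relation_module (As3_relations :: (mon \<Rightarrow>\<^sub>0 'k) set))"
    "cyclic_associator_identity 1 2 3
       \<in> orthogonal (relation_module (As3_relations :: (mon \<Rightarrow>\<^sub>0 'k) set))"
    by (auto simp: in_orthogonal_As3_iff arrangement_iff lookup_identities)
qed

text \<open>
  The last coefficient is the common value of \<open>c\<^sub>1\<^sub>2\<^sub>3 - c\<^sub>2\<^sub>1\<^sub>3\<close>, \<open>c\<^sub>2\<^sub>3\<^sub>1 - c\<^sub>3\<^sub>2\<^sub>1\<close> and \<open>c\<^sub>3\<^sub>1\<^sub>2 - c\<^sub>1\<^sub>3\<^sub>2\<close>.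
  The cyclic identity meets only the first word of each of these pairs, so the second words
  determine the coefficients of the left-alternative identities.
\<close>

lemma orthogonal_As3_decomposition:
  fixes f :: "mon \<Rightarrow>\<^sub>0 'k::field_char_0"
  assumes "f \<in> orthogonal (relation_module As3_relations)"
  shows "f =
    scale (Poly_Mapping.lookup f (left_mon 2 1 3)) (left_alternative_identity 1 2 3) +
    scale (Poly_Mapping.lookup f (left_mon 3 2 1)) (left_alternative_identity 2 3 1) +
    scale (Poly_Mapping.lookup f (left_mon 1 3 2)) (left_alternative_identity 3 1 2) +
    scale (Poly_Mapping.lookup f (left_mon 1 2 3) - Poly_Mapping.lookup f (left_mon 2 1 3))
      (cyclic_associator_identity 1 2 3)"
    (is "f = ?g")
proof (rule poly_mapping_eqI)
  fix t
  have f: "f \<in> Mag 3" using assms by (simp add: in_orthogonal_As3_iff)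
  have right: "Poly_Mapping.lookup f (right_mon a b c) = - Poly_Mapping.lookup f (left_mon a b c)"
    and third: "Poly_Mapping.lookup f (left_mon a b c) - Poly_Mapping.lookup f (left_mon b a c)
        - Poly_Mapping.lookup f (left_mon b c a) + Poly_Mapping.lookup f (left_mon c b a) = 0"
    if "arrangement a b c" for a b c
    using assms that by (auto simp: in_orthogonal_As3_iff)
  have c231: "Poly_Mapping.lookup f (left_mon 2 3 1) = Poly_Mapping.lookup f (left_mon 3 2 1)
      + (Poly_Mapping.lookup f (left_mon 1 2 3) - Poly_Mapping.lookup f (left_mon 2 1 3))"
    using third[of 1 2 3] by (simp add: arrangement_iff algebra_simps)
  have c312: "Poly_Mapping.lookup f (left_mon 3 1 2) = Poly_Mapping.lookup f (left_mon 1 3 2)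
      + (Poly_Mapping.lookup f (left_mon 1 2 3) - Poly_Mapping.lookup f (left_mon 2 1 3))"
    using third[of 2 1 3] by (simp add: arrangement_iff algebra_simps)
  show "Poly_Mapping.lookup f t = Poly_Mapping.lookup ?g t"
  proof (cases "t \<in> monomials 3")
    case True
    then obtain a b c where abc: "arrangement a b c" "t = left_mon a b c \<or> t = right_mon a b c"
      unfolding monomials_3_iff by blast
    have "Poly_Mapping.lookup f (left_mon a b c) = Poly_Mapping.lookup ?g (left_mon a b c)"
      using abc(1) unfolding arrangement_iff
      by (auto simp: lookup_identities c231 c312 simp del: One_nat_def)
    moreover have "Poly_Mapping.lookup ?g (right_mon a b c) =
        - Poly_Mapping.lookup ?g (left_mon a b c)"
      using abc(1) unfolding arrangement_iff by (auto simp: lookup_identities)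
    ultimately show ?thesis using abc right by auto
  next
    case False
    have "left_alternative_identity 1 2 3 \<in> (Mag 3 :: (mon \<Rightarrow>\<^sub>0 'k) set)"
      "left_alternative_identity 2 3 1 \<in> (Mag 3 :: (mon \<Rightarrow>\<^sub>0 'k) set)"
      "left_alternative_identity 3 1 2 \<in> (Mag 3 :: (mon \<Rightarrow>\<^sub>0 'k) set)"
      "cyclic_associator_identity 1 2 3 \<in> (Mag 3 :: (mon \<Rightarrow>\<^sub>0 'k) set)"
      by (rule dual_identities_in_Mag, simp add: arrangement_iff)+
    moreover have zero: "Poly_Mapping.lookup h t = 0" if "h \<in> Mag 3" for h :: "mon \<Rightarrow>\<^sub>0 'k"
      using that False by (auto simp: Mag_def in_keys_iff)
    ultimately show ?thesis using f by (simp add: lookup_add)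
  qed
qed

section \<open>The generated operadic ideals\<close>

lemma generated_ideal_eqI:
  assumes "R \<subseteq> S" and "\<And>I. operadic_ideal I \<Longrightarrow> R \<subseteq> I 3 \<Longrightarrow> S \<subseteq> I 3"
  shows "generated_ideal R = generated_ideal S"
proof
  fix n
  have "{I n | I. operadic_ideal I \<and> R \<subseteq> I 3} = {I n | I. operadic_ideal I \<and> S \<subseteq> I 3}"
    using assms by blast
  then show "generated_ideal R n = generated_ideal S n" by (simp add: generated_ideal_def)
qed

text \<open>
  The decomposition uses the left-alternative identity in three arrangements of its arguments;
  the two that are not among the generators lie in the ideal because it is stable under \<open>S\<^sub>3\<close>.
\<close>

lemma orthogonal_As3_subset_ideal:
  fixes I :: "nat \<Rightarrow> (mon \<Rightarrow>\<^sub>0 'k::field_char_0) set"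
  assumes I: "operadic_ideal I"
    and la: "left_alternative_identity 1 2 3 \<in> I 3"
    and cyc: "cyclic_associator_identity 1 2 3 \<in> I 3"
  shows "orthogonal (relation_module As3_relations) \<subseteq> I 3"
proof
  interpret vector_space "scale :: 'k \<Rightarrow> _" by (rule vector_space_scale)
  have sub: "subspace (I 3)" using I by (simp add: operadic_ideal_def)
  have la': "left_alternative_identity a b c \<in> I 3" if abc: "arrangement a b c" for a b c
  proof -
    obtain \<sigma> where \<sigma>: "\<sigma> permutes {1..3}" "inv \<sigma> 1 = a" "inv \<sigma> 2 = b" "inv \<sigma> 3 = c"
      using permutation_of_arrangement[OF abc] .
    then have "act (left_alternative_identity 1 2 3) \<sigma>
        = (left_alternative_identity a b c :: mon \<Rightarrow>\<^sub>0 'k)"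
      by (simp add: act_identities)
    moreover have "act (left_alternative_identity 1 2 3) \<sigma> \<in> I 3"
      using I la \<sigma>(1) by (simp add: operadic_ideal_def)
    ultimately show ?thesis by simp
  qed
  fix f :: "mon \<Rightarrow>\<^sub>0 'k"
  assume f: "f \<in> orthogonal (relation_module As3_relations)"
  show "f \<in> I 3"
    by (subst orthogonal_As3_decomposition[OF f])
       (intro subspace_add[OF sub] subspace_scale[OF sub] la' cyc; simp add: arrangement_iff)
qed

theorem proposition9:
  shows "koszul_dual (As3_relations :: (mon \<Rightarrow>\<^sub>0 'k::field_char_0) set) =
    quadratic_operad {left_alternative_identity 1 2 3, cyclic_associator_identity 1 2 3}"
proof -
  have "generated_ideal {left_alternative_identity 1 2 3, cyclic_associator_identity 1 2 3} =
    generated_ideal (orthogonal (relation_module (As3_relations :: (mon \<Rightarrow>\<^sub>0 'k) set)))"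
    using dual_identities_orthogonal_As3 orthogonal_As3_subset_ideal
    by (intro generated_ideal_eqI) auto
  then show ?thesis by (simp add: koszul_dual_def quadratic_operad_def)
qed

end
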